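(* Let $(X,d)$ be a (nonempty) complete metric space and let $T:X\to X$ be a path-averaged polynomial contraction, i.e. there exist $\alpha\in(0,1)$, $N\in\mathbb{N}$, a natural number $r\geq 1$ and a family of mappings $a_i:X\times X\to[0,\infty)$, $i=0,\dots,r$, such that for all $x,y\in X$ and all $n\geq N$ $$\sum_{k=0}^{n-1}\sum_{i=0}^{r} a_i(T^{k+1}x,T^{k+1}y)\,d^{i}(T^{k+1}x,T^{k+1}y)\leq \alpha \sum_{k=0}^{n-1}\sum_{i=0}^{r} a_i(T^{k}x,T^{k}y)\,d^{i}(T^{k}x,T^{k}y).$$ Assume that the following conditions hold: (i) $T$ is continuous; (ii) there exist an index $j\in\{1,\dots,r\}$ and a constant $A_j>0$ such that $a_j(x,y)\geq A_j$ for all $x,y\in X$. Then $T$ admits a unique fixed point $z^{*}\in X$. Moreover, for every $z_0\in X$, the Picard sequence $\{z_n\}\subset X$ defined by $z_n=T^{n}z_0$ for all $n\geq 0$ converges to $z^{*}$.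
   Context: Here $T^k$ denotes the $k$-fold iterate of $T$ (with $T^0$ the identity), and $d^{i}(x,y)$ denotes the $i$-th power $(d(x,y))^{i}$, with $d^{0}(x,y)=1$ for all $x,y$ (so the $i=0$ term is $a_0(x,y)$). The maps $a_i$ in condition (ii) are the ones appearing in the contraction inequality. No continuity or symmetry is assumed of the maps $a_i$. *)

theory Defs
  imports Complex_Main
begin

text \<open>
  The contraction property with its data made explicit, since a further hypothesis on the
  coefficient maps refers to the same family. Only \<open>a 0, \<dots>, a r\<close> are constrained. The term for
  \<open>i = 0\<close> is \<open>a 0\<close> itself, as \<open>0 ^ 0 = 1\<close>.
\<close>

definition path_averaged_polynomial_contraction ::
  "real \<Rightarrow> nat \<Rightarrow> nat \<Rightarrow> (nat \<Rightarrow> 'a \<Rightarrow> 'a \<Rightarrow> real) \<Rightarrow> ('a::metric_space \<Rightarrow> 'a) \<Rightarrow> bool"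
  where
  "path_averaged_polynomial_contraction \<alpha> N r a T \<longleftrightarrow>
     0 < \<alpha> \<and> \<alpha> < 1 \<and> 1 \<le> r \<and>
     (\<forall>i\<le>r. \<forall>x y. 0 \<le> a i x y) \<and>
     (\<forall>x y. \<forall>n\<ge>N.
        (\<Sum>k<n. \<Sum>i\<le>r. a i ((T ^^ (k + 1)) x) ((T ^^ (k + 1)) y)
                          * dist ((T ^^ (k + 1)) x) ((T ^^ (k + 1)) y) ^ i)
        \<le> \<alpha> * (\<Sum>k<n. \<Sum>i\<le>r. a i ((T ^^ k) x) ((T ^^ k) y)
                                 * dist ((T ^^ k) x) ((T ^^ k) y) ^ i))"

end

theory Submission imports Defs begin

text \<open>
  Write \<open>u k\<close> for the inner sum of the contraction inequality along the orbits of \<open>x\<close> and \<open>y\<close>.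
  The inequality bounds the partial sums of \<open>u\<close>, so \<open>u\<close> is summable. Applied to \<open>T\<^sup>m x\<close> and
  \<open>T\<^sup>m y\<close> with \<open>n\<close> tending to infinity, it shows that the tails of this series shrink by the
  factor \<open>\<alpha>\<close> at each step. Hence \<open>A * dist (T\<^sup>m x) (T\<^sup>m y) ^ j \<le> u m\<close> decays like \<open>\<alpha> ^ m\<close>, and the
  distance itself like the \<open>m\<close>-th power of the \<open>j\<close>-th root of \<open>\<alpha>\<close>. For \<open>y = T x\<close> this makes
  the Picard sequence Cauchy.
\<close>

lemma geometric_decay_of_shifted_sums:
  fixes u :: "nat \<Rightarrow> real"
  assumes \<alpha>: "0 < \<alpha>" "\<alpha> < 1"
    and nonneg: "\<And>k. 0 \<le> u k"
    and shift: "\<And>m n. N \<le> n \<Longrightarrow> (\<Sum>k<n. u (m + Suc k)) \<le> \<alpha> * (\<Sum>k<n. u (m + k))"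
  obtains C where "0 \<le> C" "\<And>m. u m \<le> C * \<alpha> ^ m"
proof -
  have "summable u"
  proof (rule summableI_nonneg_bounded[OF nonneg])
    fix n
    \<comment> \<open>The shift inequality is available only for lengths at least \<open>N\<close>,
      so the partial sum is first lengthened. With \<open>S = sum u {..<Suc M}\<close>, splitting
      off \<open>u 0\<close> gives S \<le> u 0 + \<alpha> * S, which is solved for
      \<open>S\<close>.\<close>
    define M where "M = max n N"
    have "sum u {..<Suc M} = u 0 + (\<Sum>k<M. u (Suc k))"
      by (rule sum.lessThan_Suc_shift)
    also have "\<dots> \<le> u 0 + \<alpha> * sum u {..<M}"
      using shift[of M 0] by (simp add: M_def)
    also have "\<dots> \<le> u 0 + \<alpha> * sum u {..<Suc M}"
      using \<alpha> nonneg by simp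
    finally have "sum u {..<Suc M} \<le> u 0 / (1 - \<alpha>)"
      using \<alpha> by (simp add: field_simps)
    moreover have "sum u {..<n} \<le> sum u {..<Suc M}"
      using nonneg by (intro sum_mono2) (auto simp: M_def)
    ultimately show "sum u {..<n} \<le> u 0 / (1 - \<alpha>)" by linarith
  qed
  define R where "R m = (\<Sum>k. u (m + k))" for m
  have summ: "summable (\<lambda>k. u (m + k))" for m
    using summable_ignore_initial_segment[OF \<open>summable u\<close>, of m] by (simp add: add.commute)
  \<comment> \<open>Unless \<open>N\<close> is at most 1, a single term need not shrink by \<alpha>;
    in the limit of long sums the threshold \<open>N\<close> disappears and the tails do
    shrink.\<close>
  have step: "R (Suc m) \<le> \<alpha> * R m" for m
  proof (rule LIMSEQ_le)
    show "(\<lambda>n. \<Sum>k<n. u (m + Suc k)) \<longlonglongrightarrow> R (Suc m)"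
      using summable_LIMSEQ[OF summ[of "Suc m"]] by (simp add: R_def)
    show "(\<lambda>n. \<alpha> * (\<Sum>k<n. u (m + k))) \<longlonglongrightarrow> \<alpha> * R m"
      unfolding R_def by (intro tendsto_mult_left summable_LIMSEQ summ)
    show "\<exists>K. \<forall>n\<ge>K. (\<Sum>k<n. u (m + Suc k)) \<le> \<alpha> * (\<Sum>k<n. u (m + k))"
      using shift by blast
  qed
  have tail: "R m \<le> R 0 * \<alpha> ^ m" for m
  proof (induction m)
    case (Suc m)
    have "R (Suc m) \<le> \<alpha> * R m" by (rule step)
    also have "\<dots> \<le> \<alpha> * (R 0 * \<alpha> ^ m)"
      using Suc \<alpha> by (intro mult_left_mono) auto
    finally show ?case by (simp add: mult_ac)
  qed simp
  have "u m \<le> R m" for m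
    using sum_le_suminf[OF summ[of m], of "{0}"] nonneg by (simp add: R_def)
  with tail have "u m \<le> R 0 * \<alpha> ^ m" for m
    using order_trans by blast
  moreover have "0 \<le> R 0"
    unfolding R_def by (intro suminf_nonneg summ nonneg)
  ultimately show ?thesis using that by blast
qed

text \<open>The two starting points are arbitrary because this serves twice: with
  \<open>y = T x\<close> for convergence, and with two fixed points for uniqueness.\<close>

lemma orbit_dist_geometric_decay:
  fixes T :: "'a::metric_space \<Rightarrow> 'a"
  assumes T: "path_averaged_polynomial_contraction \<alpha> N r a T"
    and j: "j \<in> {1..r}" and A: "0 < A" "\<And>x y. A \<le> a j x y"
  obtains C \<rho> where "0 < \<rho>" "\<rho> < 1"
    "\<And>n. dist ((T ^^ n) x) ((T ^^ n) y) \<le> C * \<rho> ^ n"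
proof -
  define v where "v p q = (\<Sum>i\<le>r. a i p q * dist p q ^ i)" for p q
  define u where "u k = v ((T ^^ k) x) ((T ^^ k) y)" for k
  have \<alpha>: "0 < \<alpha>" "\<alpha> < 1"
    and a: "\<And>i x y. i \<le> r \<Longrightarrow> 0 \<le> a i x y"
    and contr: "\<And>p q n. N \<le> n \<Longrightarrow>
      (\<Sum>k<n. v ((T ^^ Suc k) p) ((T ^^ Suc k) q)) \<le> \<alpha> * (\<Sum>k<n. v ((T ^^ k) p) ((T ^^ k) q))"
    using T by (simp_all add: path_averaged_polynomial_contraction_def v_def)
  have iter: "(T ^^ k) ((T ^^ m) p) = (T ^^ (m + k)) p" for k m p
    by (metis add.commute comp_apply funpow_add)
  have shift: "(\<Sum>k<n. u (m + Suc k)) \<le> \<alpha> * (\<Sum>k<n. u (m + k))" if "N \<le> n" for m n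
    using contr[OF that, of "(T ^^ m) x" "(T ^^ m) y"] unfolding u_def iter .
  have "0 \<le> u k" for k
    unfolding u_def v_def using a by (intro sum_nonneg mult_nonneg_nonneg) auto
  then obtain C where C: "0 \<le> C" "\<And>m. u m \<le> C * \<alpha> ^ m"
    using geometric_decay_of_shifted_sums[OF \<alpha> _ shift] by blast
  have "dist ((T ^^ n) x) ((T ^^ n) y) \<le> root j (C / A) * root j \<alpha> ^ n" for n
  proof -
    define d where "d = dist ((T ^^ n) x) ((T ^^ n) y)"
    have "A * d ^ j \<le> a j ((T ^^ n) x) ((T ^^ n) y) * d ^ j"
      using A by (intro mult_right_mono) (auto simp: d_def)
    \<comment> \<open>The term of index \<open>j\<close> is one summand among nonnegative
      ones.\<close>
    also have "\<dots> \<le> u n"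
      unfolding u_def v_def d_def using j a
      by (intro member_le_sum[where f = "\<lambda>i. a i _ _ * dist _ _ ^ i"]) auto
    also have "\<dots> \<le> C * \<alpha> ^ n" by (rule C)
    finally have "d ^ j \<le> C / A * \<alpha> ^ n"
      using A by (simp add: field_simps)
    then have "root j (d ^ j) \<le> root j (C / A * \<alpha> ^ n)"
      using j by simp
    \<comment> \<open>The deleted simp rule would merge \<open>C / A\<close> with the power of
      \<alpha>; kept apart, the root splits over the product as in the goal.\<close>
    then show ?thesis
      using j \<alpha> by (simp add: d_def real_root_power_cancel real_root_mult real_root_power
          del: times_divide_eq_left)
  qed
  moreover have "0 < root j \<alpha>" "root j \<alpha> < 1"
    using j \<alpha> by auto
  ultimately show ?thesis using that by blast
qed

text \<open>The iterated triangle inequality bounds \<open>dist (X m) (X n)\<close> by a block of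
  the series, and such blocks are eventually small.\<close>

lemma Cauchy_if_summable_dist:
  fixes X :: "nat \<Rightarrow> 'a::metric_space"
  assumes "summable (\<lambda>n. dist (X n) (X (Suc n)))"
  shows "Cauchy X"
  unfolding Cauchy_altdef
proof (intro allI impI)
  fix e :: real
  assume "0 < e"
  then obtain M where M: "\<And>m n. M \<le> m \<Longrightarrow> (\<Sum>k=m..<n. dist (X k) (X (Suc k))) < e"
    using assms unfolding summable_Cauchy by (metis abs_ge_self le_less_trans real_norm_def)
  have "dist (X m) (X n) \<le> (\<Sum>k=m..<n. dist (X k) (X (Suc k)))" if "m \<le> n" for m n
    using that
  proof (induction n rule: dec_induct)
    case (step n)
    then show ?case
      using dist_triangle[of "X m" "X (Suc n)" "X n"] by simp
  qed simp
  with M show "\<exists>M. \<forall>m\<ge>M. \<forall>n>m. dist (X m) (X n) < e"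
    by (meson le_less_trans less_imp_le)
qed

theorem theorem2p3:
  fixes T :: "'a::complete_space \<Rightarrow> 'a"
    and a :: "nat \<Rightarrow> 'a \<Rightarrow> 'a \<Rightarrow> real"
    and \<alpha> :: real and N r :: nat
  assumes "path_averaged_polynomial_contraction \<alpha> N r a T"
    and "continuous_on UNIV T"
    and "\<exists>j\<in>{1..r}. \<exists>A>0. \<forall>x y. a j x y \<ge> A"
  shows "\<exists>z. T z = z \<and> (\<forall>w. T w = w \<longrightarrow> w = z) \<and>
             (\<forall>z0. (\<lambda>n. (T ^^ n) z0) \<longlonglongrightarrow> z)"
proof -
  obtain j A where jA: "j \<in> {1..r}" "0 < A" "\<And>x y. A \<le> a j x y"
    using assms(3) by blast
  note decay = orbit_dist_geometric_decay[OF assms(1) jA]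
  have fixpoint: "\<exists>z. (\<lambda>n. (T ^^ n) z0) \<longlonglongrightarrow> z \<and> T z = z" for z0
  proof -
    obtain C \<rho> where \<rho>: "0 < \<rho>" "\<rho> < 1"
      and le: "\<And>n. dist ((T ^^ n) z0) ((T ^^ n) (T z0)) \<le> C * \<rho> ^ n"
      using decay by blast
    have "summable (\<lambda>n. dist ((T ^^ n) z0) ((T ^^ Suc n) z0))"
    proof (rule summable_comparison_test')
      show "summable (\<lambda>n. C * \<rho> ^ n)"
        using \<rho> by (intro summable_mult summable_geometric) simp
    qed (use le in \<open>simp add: funpow_swap1\<close>)
    then have "convergent (\<lambda>n. (T ^^ n) z0)"
      by (intro Cauchy_convergent Cauchy_if_summable_dist)
    then obtain z where z: "(\<lambda>n. (T ^^ n) z0) \<longlonglongrightarrow> z"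
      unfolding convergent_def by blast
    \<comment> \<open>The shifted orbit tends to \<open>T z\<close> by continuity and to
      \<open>z\<close> as a tail of the orbit.\<close>
    then have "(\<lambda>n. T ((T ^^ n) z0)) \<longlonglongrightarrow> T z"
      using assms(2) by (intro continuous_on_tendsto_compose[of UNIV T]) auto
    moreover have "(\<lambda>n. T ((T ^^ n) z0)) \<longlonglongrightarrow> z"
      using LIMSEQ_Suc[OF z] by simp
    ultimately show ?thesis using z LIMSEQ_unique by blast
  qed
  have unique: "w = z" if "T w = w" "T z = z" for w z
  proof -
    obtain C \<rho> where \<rho>: "0 < \<rho>" "\<rho> < 1"
      and le: "\<And>n. dist ((T ^^ n) w) ((T ^^ n) z) \<le> C * \<rho> ^ n"
      using decay by blast
    \<comment> \<open>Orbits of fixed points are constant, so the decaying bound applies to the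
      fixed number \<open>dist w z\<close>.\<close>
    have "(T ^^ n) p = p" if "T p = p" for n p
      using that by (induction n) auto
    with le that have "dist w z \<le> C * \<rho> ^ n" for n
      by metis
    moreover have "(\<lambda>n. C * \<rho> ^ n) \<longlonglongrightarrow> C * 0"
      using \<rho> by (intro tendsto_mult_left LIMSEQ_realpow_zero) auto
    ultimately have "dist w z \<le> C * 0"
      by (intro LIMSEQ_le_const) auto
    then show ?thesis by simp
  qed
  \<comment> \<open>The limit in \<open>fixpoint\<close> may depend on \<open>z0\<close>; since it
    is always a fixed point, \<open>unique\<close> makes all these limits equal.\<close>
  show ?thesis using fixpoint unique by metis
qed

end
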